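(* Let $B$ be a Blaschke product. Suppose that the zeros of $B$ do not cluster at a set of positive Lebesgue measure, i.e. the set of cluster points of the zeros of $B$ on the unit circle has Lebesgue measure zero. Then the Bass stable rank of $A(\mathbb{D})_B$ is $1$.
   Context: $\mathbb{D}=\{z\in\mathbb{C}:|z|<1\}$; $A(\mathbb{D})$ is the disk algebra, i.e. the algebra of bounded holomorphic functions on $\mathbb{D}$ having a continuous extension to $\overline{\mathbb{D}}$, with pointwise operations. A Blaschke product $B$ with (finitely or infinitely many) distinct zeros $a_k\in\mathbb{D}$, $k\ge1$, of multiplicity $m_k\geq 1$ is $B=\prod_{k\ge1}\left(\frac{|a_k|}{a_k}\varphi_{a_k}\right)^{m_k}$, where $\varphi_a(z)=\frac{a-z}{1-\overline{a}z}$, $\sum_{k\ge1}m_k(1-|a_k|)<\infty$, and the factor $\frac{|a_k|}{a_k}$ is interpreted as $-1$ if $a_k=0$. $A(\mathbb{D})_B$ is the set of all $f\in A(\mathbb{D})$ such that $f(a_j)=f(a_k)$ for all $j,k$, and $f^{(m)}(a_k)=0$ for all $k$ and all $1\le m\le m_k-1$; equivalently $A(\mathbb{D})_B=(\mathbb{C}+BH^\infty)\cap A(\mathbb{D})$, where $H^\infty$ is the algebra of bounded holomorphic functions on $\mathbb{D}$. Let $A$ be an algebra with unit $e$. An $n$-tuple $a\in A^n$ is called unimodular if there exists $b\in A^n$ with $\sum_{j=1}^n a_jb_j=e$. An $n$-tuple $a$ is called reducible if there exists an $(n-1)$-tuple $x\in A^{n-1}$ such that $(a_1+x_1a_n,\dots,a_{n-1}+x_{n-1}a_n)$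 is unimodular. The Bass stable rank of $A$ is the least integer $n\ge1$ such that every unimodular $(n+1)$-tuple is reducible. *)

theory Defs
  imports "HOL-Complex_Analysis.Complex_Analysis" "HOL-Algebra.Ring"
begin

abbreviation unit_disk :: "complex set" where
  "unit_disk \<equiv> ball 0 1"


section \<open>Bass stable rank\<close>

text \<open>
  The scalar multiplication of an algebra plays no role in these notions, so they are
  stated for rings. An \<open>n\<close>-tuple is a function of which only the values at \<open>1, \<dots>, n\<close> matter.
\<close>

definition unimodular :: "('a, 'b) ring_scheme \<Rightarrow> nat \<Rightarrow> (nat \<Rightarrow> 'a) \<Rightarrow> bool" where
  "unimodular R n a \<longleftrightarrow>
     a \<in> {1..n} \<rightarrow> carrier R \<and>
     (\<exists>b \<in> {1..n} \<rightarrow> carrier R.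
        (\<Oplus>\<^bsub>R\<^esub>j\<in>{1..n}. a j \<otimes>\<^bsub>R\<^esub> b j) = \<one>\<^bsub>R\<^esub>)"

definition reducible :: "('a, 'b) ring_scheme \<Rightarrow> nat \<Rightarrow> (nat \<Rightarrow> 'a) \<Rightarrow> bool" where
  "reducible R n a \<longleftrightarrow>
     (\<exists>x \<in> {1..n-1} \<rightarrow> carrier R.
        unimodular R (n - 1) (\<lambda>j. a j \<oplus>\<^bsub>R\<^esub> x j \<otimes>\<^bsub>R\<^esub> a n))"

text \<open>The infimum is taken in \<^typ>\<open>enat\<close>, so the rank is \<open>\<infinity>\<close> if no such \<open>n\<close> exists.\<close>

definition bass_stable_rank :: "('a, 'b) ring_scheme \<Rightarrow> enat" where
  "bass_stable_rank R =
     Inf {enat n | n. 1 \<le> n \<and> (\<forall>a. unimodular R (n + 1) a \<longrightarrow> reducible R (n + 1) a)}"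


section \<open>Blaschke products\<close>

definition disk_moebius :: "complex \<Rightarrow> complex \<Rightarrow> complex" where
  "disk_moebius a z = (a - z) / (1 - cnj a * z)"

definition blaschke_factor :: "complex \<Rightarrow> complex \<Rightarrow> complex" where
  "blaschke_factor a z =
     (if a = 0 then - 1 else complex_of_real (cmod a) / a) * disk_moebius a z"

text \<open>
  \<open>N\<close> is the number of distinct zeros; \<open>N = \<infinity>\<close> is the case of infinitely many.
\<close>

definition zero_indices :: "enat \<Rightarrow> nat set" where
  "zero_indices N = {k. 1 \<le> k \<and> enat k \<le> N}"

text \<open>
  \<open>B\<close> is, on the unit disk, the Blaschke product whose distinct zeros are \<open>a k\<close> with
  multiplicity \<open>m k\<close>, for \<open>k\<close> in \<open>zero_indices N\<close>. Values of \<open>a\<close> and \<open>m\<close> at other indices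
  are irrelevant, and so are the values of \<open>B\<close> outside the disk.
\<close>

definition blaschke_product ::
  "(complex \<Rightarrow> complex) \<Rightarrow> enat \<Rightarrow> (nat \<Rightarrow> complex) \<Rightarrow> (nat \<Rightarrow> nat) \<Rightarrow> bool" where
  "blaschke_product B N a m \<longleftrightarrow>
     a ` zero_indices N \<subseteq> unit_disk \<and>
     inj_on a (zero_indices N) \<and>
     (\<forall>k\<in>zero_indices N. 1 \<le> m k) \<and>
     (\<lambda>k. real (m k) * (1 - cmod (a k))) summable_on zero_indices N \<and>
     (\<forall>z\<in>unit_disk.
        (\<lambda>k. if k \<in> zero_indices N then blaschke_factor (a k) z ^ m k else 1) has_prod B z)"


section \<open>The disk algebra and its subalgebra attached to a Blaschke product\<close>

text \<open>
  Functions on the disk are represented by functions in \<^term>\<open>extensional unit_disk\<close>, so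
  that two of them are equal as soon as they agree on the disk.
\<close>

definition disk_algebra :: "(complex \<Rightarrow> complex) set" where
  "disk_algebra =
     {f \<in> extensional unit_disk.
        f holomorphic_on unit_disk \<and> bounded (f ` unit_disk) \<and>
        (\<exists>g. continuous_on (closure unit_disk) g \<and> (\<forall>z\<in>unit_disk. g z = f z))}"

definition disk_algebra_B ::
  "enat \<Rightarrow> (nat \<Rightarrow> complex) \<Rightarrow> (nat \<Rightarrow> nat) \<Rightarrow> (complex \<Rightarrow> complex) ring" where
  "disk_algebra_B N a m =
     \<lparr>carrier = {f \<in> disk_algebra.
         (\<forall>j\<in>zero_indices N. \<forall>k\<in>zero_indices N. f (a j) = f (a k)) \<and>
         (\<forall>k\<in>zero_indices N. \<forall>i\<in>{1..m k - 1}. (deriv ^^ i) f (a k) = 0)},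
      mult = (\<lambda>f g. \<lambda>z\<in>unit_disk. f z * g z),
      one = (\<lambda>z\<in>unit_disk. 1),
      zero = (\<lambda>z\<in>unit_disk. 0),
      add = (\<lambda>f g. \<lambda>z\<in>unit_disk. f z + g z)\<rparr>"


section \<open>Boundary behaviour of the zeros\<close>

definition boundary_cluster_set :: "complex set \<Rightarrow> complex set" where
  "boundary_cluster_set Z = {w \<in> sphere 0 1. w islimpt Z}"

text \<open>Lebesgue (arc length) measure on the circle is that of the angle parameter.\<close>

definition circle_null :: "complex set \<Rightarrow> bool" where
  "circle_null E \<longleftrightarrow> {t \<in> {0..<2 * pi}. cis t \<in> E} \<in> null_sets lebesgue"

end

theory Submission
  imports Defs "HOL-Computational_Algebra.Fundamental_Theorem_Algebra"
begin

text \<open>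
  The rank is at least \<open>1\<close> by definition, so the claim is that every unimodular pair
  \<open>(f, g)\<close> of the algebra is reducible: \<open>f + h g\<close> has no zero on the closed disk for some
  \<open>h\<close> in the algebra. Such a sum is then invertible, as the algebra is closed under
  reciprocals by the Leibniz rule.

  Two ideas carry the proof. The first reduces the claim to the full disk algebra, which is
  the algebra itself if the Blaschke product has no zeros. Otherwise \<open>f\<close> and \<open>g\<close> do not both
  vanish at these zeros, so adding a constant multiple of \<open>g\<close> to \<open>f\<close> makes the common value
  \<open>\<gamma>\<close> of \<open>f\<close> there nonzero. Then \<open>f - \<gamma>\<close> vanishes at each zero to the prescribed order, so
  every multiple of \<open>f - \<gamma>\<close> in the disk algebra lies in the subalgebra. Moreover, \<open>f\<close> is
  comaximal with \<open>f - \<gamma>\<close>, because their difference is a nonzero constant, hence also with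
  \<open>g (f - \<gamma>)\<close>. If the disk algebra provides \<open>h\<close> such that \<open>f + h (f - \<gamma>) g\<close> has no zero, the
  coefficient \<open>h (f - \<gamma>)\<close> is in the subalgebra (\<open>reducible_constant_on_divisor\<close>).

  The second idea is an elementary proof that the disk algebra has stable rank \<open>1\<close>
  (\<open>unit_residue_of_bezout\<close>). Fix \<open>G\<close> and consider the functions that are congruent to an
  invertible one modulo \<open>G\<close>. They are closed under products, and among the functions
  comaximal with \<open>G\<close> this property does not change under small perturbations
  (\<open>unit_residue_perturb\<close>). Hence \<open>f\<close> may be replaced by a polynomial, the polynomial
  by its linear factors, and it remains to treat \<open>z - l\<close> for \<open>l\<close> with \<open>G l \<noteq> 0\<close>. If \<open>l\<close> lies
  outside the closed disk, \<open>z - l\<close> is itself invertible. Any other \<open>l\<close> can be moved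
  there: the open disk without the zeros of \<open>G\<close> is connected, the property is locally
  constant in \<open>l\<close> on it, and it persists when \<open>l\<close> crosses the unit circle
  near a point at which \<open>G\<close> does not vanish (\<open>unit_residue_linear_at_boundary\<close>).
\<close>

section \<open>Continuous functions on the closed disk that are holomorphic inside\<close>

definition closed_disk_algebra :: "(complex \<Rightarrow> complex) set" where
  "closed_disk_algebra = {f. continuous_on (cball 0 1) f \<and> f holomorphic_on ball 0 1}"

lemma closed_disk_algebraI:
  "continuous_on (cball 0 1) f \<Longrightarrow> f holomorphic_on ball 0 1 \<Longrightarrow> f \<in> closed_disk_algebra"
  by (simp add: closed_disk_algebra_def)

lemma closed_disk_algebraD:
  assumes "f \<in> closed_disk_algebra"
  shows "continuous_on (cball 0 1) f" "f holomorphic_on ball 0 1"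
  using assms by (simp_all add: closed_disk_algebra_def)

lemma closed_disk_algebra_const [simp]: "(\<lambda>z. c) \<in> closed_disk_algebra"
  by (intro closed_disk_algebraI continuous_intros holomorphic_intros)

lemma closed_disk_algebra_ident [simp]: "(\<lambda>z. z) \<in> closed_disk_algebra"
  by (intro closed_disk_algebraI continuous_intros holomorphic_intros)

lemma closed_disk_algebra_add:
  "f \<in> closed_disk_algebra \<Longrightarrow> g \<in> closed_disk_algebra \<Longrightarrow>
    (\<lambda>z. f z + g z) \<in> closed_disk_algebra"
  by (intro closed_disk_algebraI continuous_intros holomorphic_intros) (auto dest: closed_disk_algebraD)

lemma closed_disk_algebra_diff:
  "f \<in> closed_disk_algebra \<Longrightarrow> g \<in> closed_disk_algebra \<Longrightarrow>
    (\<lambda>z. f z - g z) \<in> closed_disk_algebra"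
  by (intro closed_disk_algebraI continuous_intros holomorphic_intros) (auto dest: closed_disk_algebraD)

lemma closed_disk_algebra_mult:
  "f \<in> closed_disk_algebra \<Longrightarrow> g \<in> closed_disk_algebra \<Longrightarrow>
    (\<lambda>z. f z * g z) \<in> closed_disk_algebra"
  by (intro closed_disk_algebraI continuous_intros holomorphic_intros) (auto dest: closed_disk_algebraD)

lemma closed_disk_algebra_divide:
  assumes "f \<in> closed_disk_algebra" "g \<in> closed_disk_algebra"
    and "\<And>z. z \<in> cball 0 1 \<Longrightarrow> g z \<noteq> 0"
  shows "(\<lambda>z. f z / g z) \<in> closed_disk_algebra"
  using assms
  by (intro closed_disk_algebraI continuous_intros holomorphic_intros) (auto dest: closed_disk_algebraD)

lemma closed_disk_algebra_poly [simp]: "poly p \<in> closed_disk_algebra"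
  by (intro closed_disk_algebraI continuous_intros holomorphic_intros)

lemmas closed_disk_algebra_intros =
  closed_disk_algebra_const closed_disk_algebra_ident closed_disk_algebra_poly
  closed_disk_algebra_add closed_disk_algebra_diff closed_disk_algebra_mult
  closed_disk_algebra_divide

lemma closed_disk_algebra_bounded:
  assumes "f \<in> closed_disk_algebra"
  obtains K where "K > 0" "\<And>z. z \<in> cball 0 1 \<Longrightarrow> cmod (f z) \<le> K"
proof -
  have "bounded (f ` cball 0 1)"
    using assms by (intro compact_imp_bounded compact_continuous_image) (auto dest: closed_disk_algebraD)
  then show ?thesis
    using that by (auto simp: bounded_pos)
qed

lemma closed_disk_algebra_maximum_modulus:
  assumes "f \<in> closed_disk_algebra" "\<And>z. cmod z = 1 \<Longrightarrow> cmod (f z) \<le> C" "z \<in> cball 0 1"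
  shows "cmod (f z) \<le> C"
  using maximum_modulus_frontier[of f "cball 0 1" C z] assms
  by (auto dest: closed_disk_algebraD)

lemma closed_disk_algebra_difference_quotient:
  assumes f: "f \<in> closed_disk_algebra" and a: "a \<in> ball 0 1"
  shows "(\<lambda>z. if z = a then deriv f a else (f z - f a) / (z - a)) \<in> closed_disk_algebra"
    (is "?q \<in> _")
proof -
  have holo: "?q holomorphic_on ball 0 1"
    using f a by (intro pole_lemma) (auto dest: closed_disk_algebraD)
  have "continuous_on (cball 0 1 - {a}) (\<lambda>z. (f z - f a) / (z - a))"
    by (intro continuous_intros continuous_on_subset[OF closed_disk_algebraD(1)[OF f]]) auto
  then have "continuous_on (cball 0 1 - {a}) ?q"
    by (rule continuous_on_eq) auto
  moreover have "openin (top_of_set (cball 0 1)) (cball 0 1 - {a})"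
    by (simp add: openin_delete)
  moreover have "openin (top_of_set (cball 0 1)) (ball (0::complex) 1)"
    by (meson ball_subset_cball open_ball open_openin_trans openin_open_eq openin_subset open_subset)
  moreover have "cball 0 1 = ball 0 1 \<union> (cball 0 1 - {a})"
    using a by auto
  ultimately have "continuous_on (cball 0 1) ?q"
    using continuous_on_Un_local_open holomorphic_on_imp_continuous_on[OF holo]
    by (metis (no_types, lifting))
  with holo show ?thesis
    by (intro closed_disk_algebraI)
qed

text \<open>
  A dilation \<open>z \<mapsto> f (r z)\<close> with \<open>r < 1\<close> close to \<open>1\<close> is uniformly close to \<open>f\<close> and
  holomorphic on a larger disk, so its Taylor polynomials converge uniformly on the closed
  unit disk.
\<close>

lemma closed_disk_algebra_polynomial_approximation:
  assumes f: "f \<in> closed_disk_algebra" and "e > 0"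
  obtains p where "\<And>z. z \<in> cball 0 1 \<Longrightarrow> cmod (f z - poly p z) < e"
proof -
  have "uniformly_continuous_on (cball 0 1) f"
    using f by (intro compact_uniformly_continuous) (auto dest: closed_disk_algebraD)
  then obtain d where "d > 0"
    and d: "\<And>x y. x \<in> cball 0 1 \<Longrightarrow> y \<in> cball 0 1 \<Longrightarrow> dist y x < d \<Longrightarrow> dist (f y) (f x) < e / 2"
    by (rule uniformly_continuous_onE[OF _ half_gt_zero[OF \<open>e > 0\<close>]]) (rule that)
  define s where "s = min (1/2) (d/2)"
  define r where "r = 1 - s"
  have s: "0 < s" "s \<le> 1/2" "s < d"
    using \<open>d > 0\<close> by (auto simp: s_def)
  then have r: "0 < r" "r < 1"
    by (auto simp: r_def)
  define F where "F = (\<lambda>z. f (of_real r * z))"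
  define c where "c = (\<lambda>n. (deriv ^^ n) F 0 / fact n)"
  have "F holomorphic_on ball 0 (1/r)"
  proof -
    have "(f \<circ> (\<lambda>z. of_real r * z)) holomorphic_on ball 0 (1/r)"
      using r by (intro holomorphic_on_compose_gen[OF _ closed_disk_algebraD(2)[OF f]] holomorphic_intros)
        (auto simp: norm_mult field_simps)
    then show ?thesis
      by (simp add: F_def o_def)
  qed
  then have sums: "(\<lambda>n. c n * z ^ n) sums F z" if "z \<in> ball 0 (1/r)" for z
    using holomorphic_power_series[of F 0 "1/r" z] that by (simp add: c_def)
  have "conv_radius c \<ge> 1/r"
  proof (rule conv_radius_geI_ex')
    fix t assume t: "0 < t" "ereal t < ereal (1/r)"
    then show "summable (\<lambda>n. c n * of_real t ^ n)"
      using sums[of "of_real t"] by (auto simp: sums_iff)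
  qed
  moreover have "ereal 1 < ereal (1/r)"
    using r by simp
  ultimately have "ereal 1 < conv_radius c"
    by (rule less_le_trans[rotated])
  then have "uniform_limit (cball 0 1) (\<lambda>n z. \<Sum>i<n. c i * (z - 0) ^ i) (\<lambda>z. \<Sum>i. c i * (z - 0) ^ i) sequentially"
    by (rule powser_uniform_limit)
  then have "\<forall>\<^sub>F n in sequentially. \<forall>z\<in>cball 0 1.
      dist (\<Sum>i<n. c i * (z - 0) ^ i) (\<Sum>i. c i * (z - 0) ^ i) < e / 2"
    using \<open>e > 0\<close> unfolding uniform_limit_iff by (meson half_gt_zero)
  from eventually_happens'[OF sequentially_bot this]
  obtain n where n: "\<And>z. z \<in> cball 0 1 \<Longrightarrow>
      dist (\<Sum>i<n. c i * z ^ i) (\<Sum>i. c i * z ^ i) < e / 2"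
    unfolding diff_zero by blast
  define p where "p = (\<Sum>i<n. monom (c i) i)"
  show ?thesis
  proof (rule that)
    fix z :: complex assume z: "z \<in> cball 0 1"
    have "1 < 1 / r"
      using r by simp
    then have "z \<in> ball 0 (1/r)"
      using z by (simp del: less_divide_eq_1_pos)
    then have "(\<Sum>i. c i * z ^ i) = F z"
      using sums by (simp add: sums_iff)
    then have 1: "dist (poly p z) (F z) < e / 2"
      using n[OF z] by (simp add: p_def poly_sum poly_monom)
    have rz: "of_real r * z \<in> cball 0 1"
      using z r by (auto simp: norm_mult mult_le_one)
    have "z - of_real r * z = of_real s * z"
      by (simp add: r_def algebra_simps)
    then have "dist z (of_real r * z) = s * cmod z"
      using s by (simp add: dist_norm norm_mult)
    moreover have "s * cmod z \<le> s"
      using z s by (intro mult_left_le) auto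
    ultimately have "dist z (of_real r * z) < d"
      using s by linarith
    then have 2: "dist (f z) (F z) < e / 2"
      unfolding F_def using d z rz by blast
    show "cmod (f z - poly p z) < e"
      using dist_triangle_half_r[of "F z" "f z" e "poly p z"] 1 2
      by (simp add: dist_norm norm_minus_commute)
  qed
qed


section \<open>Units of the disk algebra modulo one element\<close>

text \<open>
  On the closed disk a function of the algebra is invertible iff it has no zero there, so
  \<open>f\<close> has this property iff its residue class modulo \<open>G\<close> contains a unit. If \<open>f\<close> and \<open>G\<close> are
  comaximal, this says that the pair is reducible.
\<close>

definition unit_residue :: "(complex \<Rightarrow> complex) \<Rightarrow> (complex \<Rightarrow> complex) \<Rightarrow> bool" where
  "unit_residue G f \<longleftrightarrow>
     (\<exists>h \<in> closed_disk_algebra. \<forall>z \<in> cball 0 1. f z + h z * G z \<noteq> 0)"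

lemma unit_residue_nonvanishing:
  assumes "\<And>z. z \<in> cball 0 1 \<Longrightarrow> f z \<noteq> 0"
  shows "unit_residue G f"
  unfolding unit_residue_def using assms by (intro bexI[of _ "\<lambda>z. 0"]) auto

lemma unit_residue_mult:
  assumes algebra: "G \<in> closed_disk_algebra" "f \<in> closed_disk_algebra" "g \<in> closed_disk_algebra"
    and "unit_residue G f" "unit_residue G g"
  shows "unit_residue G (\<lambda>z. f z * g z)"
proof -
  obtain h k where hk_algebra: "h \<in> closed_disk_algebra" "k \<in> closed_disk_algebra"
    and hk: "\<And>z. z \<in> cball 0 1 \<Longrightarrow> f z + h z * G z \<noteq> 0" "\<And>z. z \<in> cball 0 1 \<Longrightarrow> g z + k z * G z \<noteq> 0"
    using assms unfolding unit_residue_def by blast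
  show ?thesis
    unfolding unit_residue_def
  proof (intro bexI ballI)
    show "(\<lambda>z. f z * k z + h z * (g z + k z * G z)) \<in> closed_disk_algebra"
      using algebra hk_algebra by (intro closed_disk_algebra_intros)
    show "f z * g z + (f z * k z + h z * (g z + k z * G z)) * G z \<noteq> 0" if "z \<in> cball 0 1" for z
    proof -
      have "f z * g z + (f z * k z + h z * (g z + k z * G z)) * G z
          = (f z + h z * G z) * (g z + k z * G z)"
        by (simp add: algebra_simps)
      with hk that show ?thesis
        by simp
    qed
  qed
qed

text \<open>
  Modulo \<open>G\<close>, the product \<open>f u\<close> is a unit. Dividing it by a unit congruent to \<open>f\<close>
  exhibits a unit congruent to \<open>u\<close>.
\<close>

lemma unit_residue_cofactor:
  assumes algebra: "G \<in> closed_disk_algebra" "f \<in> closed_disk_algebra" "u \<in> closed_disk_algebra"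
      "v \<in> closed_disk_algebra"
    and e: "\<And>z. z \<in> cball 0 1 \<Longrightarrow> f z * u z + G z * v z \<noteq> 0"
    and "unit_residue G f"
  shows "unit_residue G u"
proof -
  obtain h where h_algebra: "h \<in> closed_disk_algebra"
    and h: "\<And>z. z \<in> cball 0 1 \<Longrightarrow> f z + h z * G z \<noteq> 0"
    using assms unfolding unit_residue_def by blast
  show ?thesis
    unfolding unit_residue_def
  proof (intro bexI ballI)
    show "(\<lambda>z. (v z - h z * u z) / (f z + h z * G z)) \<in> closed_disk_algebra"
      using algebra h_algebra h by (intro closed_disk_algebra_intros)
    show "u z + (v z - h z * u z) / (f z + h z * G z) * G z \<noteq> 0" if "z \<in> cball 0 1" for z
    proof -
      have "u z + (v z - h z * u z) / (f z + h z * G z) * G z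
          = (f z * u z + G z * v z) / (f z + h z * G z)"
        using h[OF that] by (simp add: field_simps)
      with h e that show ?thesis
        by simp
    qed
  qed
qed

lemma unit_residue_cofactor_iff:
  assumes "G \<in> closed_disk_algebra" "f \<in> closed_disk_algebra" "u \<in> closed_disk_algebra"
      "v \<in> closed_disk_algebra"
    and "\<And>z. z \<in> cball 0 1 \<Longrightarrow> f z * u z + G z * v z \<noteq> 0"
  shows "unit_residue G f \<longleftrightarrow> unit_residue G u"
proof
  show "unit_residue G u" if "unit_residue G f"
    using assms that by (rule unit_residue_cofactor)
  show "unit_residue G f" if "unit_residue G u"
  proof (rule unit_residue_cofactor[OF assms(1,3,2,4) _ that])
    show "u z * f z + G z * v z \<noteq> 0" if "z \<in> cball 0 1" for z
      using assms(5)[OF that] by (simp add: mult.commute[of "u z"])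
  qed
qed

text \<open>
  The same \<open>u\<close> inverts both \<open>f\<close> and \<open>g\<close> modulo \<open>G\<close>, up to a unit: the Bezout combination of
  \<open>g\<close> differs from \<open>1\<close> by less than \<open>1\<close>. So each of \<open>f\<close> and \<open>g\<close> stands or falls with \<open>u\<close>.
\<close>

lemma unit_residue_perturb:
  assumes "G \<in> closed_disk_algebra" "f \<in> closed_disk_algebra" "g \<in> closed_disk_algebra"
      "u \<in> closed_disk_algebra" "v \<in> closed_disk_algebra"
    and bezout: "\<And>z. z \<in> cball 0 1 \<Longrightarrow> f z * u z + G z * v z = 1"
    and near: "\<And>z. z \<in> cball 0 1 \<Longrightarrow> cmod ((g z - f z) * u z) < 1"
  shows "unit_residue G f \<longleftrightarrow> unit_residue G g"
proof -
  have "g z * u z + G z * v z \<noteq> 0" if "z \<in> cball 0 1" for z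
  proof
    assume "g z * u z + G z * v z = 0"
    moreover have "(g z - f z) * u z = (g z * u z + G z * v z) - (f z * u z + G z * v z)"
      by (simp add: algebra_simps)
    ultimately have "(g z - f z) * u z = - 1"
      using bezout[OF that] by simp
    with near[OF that] show False
      by simp
  qed
  then have "unit_residue G g \<longleftrightarrow> unit_residue G u"
    using assms by (intro unit_residue_cofactor_iff[where v = v]) auto
  moreover have "unit_residue G f \<longleftrightarrow> unit_residue G u"
    using assms by (intro unit_residue_cofactor_iff[where v = v]) auto
  ultimately show ?thesis
    by simp
qed


section \<open>Linear factors\<close>

text \<open>
  The cofactor is minus the difference quotient of \<open>G\<close> at \<open>l\<close>, divided by \<open>G l\<close>.
\<close>

lemma linear_factor_bezout:
  assumes G: "G \<in> closed_disk_algebra" and l: "l \<in> ball 0 1" "G l \<noteq> 0"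
  obtains u where "u \<in> closed_disk_algebra"
    "\<And>z. z \<in> cball 0 1 \<Longrightarrow> (z - l) * u z + G z * (1 / G l) = 1"
proof -
  define q where "q = (\<lambda>z. if z = l then deriv G l else (G z - G l) / (z - l))"
  have q: "q \<in> closed_disk_algebra"
    unfolding q_def using G l by (intro closed_disk_algebra_difference_quotient)
  show ?thesis
  proof (rule that)
    show "(\<lambda>z. - (1 / G l) * q z) \<in> closed_disk_algebra"
      using q by (intro closed_disk_algebra_intros)
    show "(z - l) * (- (1 / G l) * q z) + G z * (1 / G l) = 1" if "z \<in> cball 0 1" for z
      using l by (cases "z = l") (auto simp: q_def field_simps)
  qed
qed

lemma unit_residue_linear_outside:
  assumes "cmod l > 1"
  shows "unit_residue G (\<lambda>z. z - l)"
  using assms by (intro unit_residue_nonvanishing) auto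

lemma unit_residue_linear_locally_constant:
  assumes G: "G \<in> closed_disk_algebra" and l: "l \<in> ball 0 1" "G l \<noteq> 0"
  obtains d where "d > 0"
    "\<And>k. cmod (k - l) < d \<Longrightarrow> unit_residue G (\<lambda>z. z - l) \<longleftrightarrow> unit_residue G (\<lambda>z. z - k)"
proof -
  obtain u where u: "u \<in> closed_disk_algebra"
    and bezout: "\<And>z. z \<in> cball 0 1 \<Longrightarrow> (z - l) * u z + G z * (1 / G l) = 1"
    using linear_factor_bezout[OF assms] by blast
  obtain K where "K > 0" and K: "\<And>z. z \<in> cball 0 1 \<Longrightarrow> cmod (u z) \<le> K"
    using closed_disk_algebra_bounded[OF u] by blast
  show ?thesis
  proof (rule that)
    show "1 / K > 0"
      using \<open>K > 0\<close> by simp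
    fix k assume k: "cmod (k - l) < 1 / K"
    have "cmod (((z - k) - (z - l)) * u z) < 1" if "z \<in> cball 0 1" for z
    proof -
      have "cmod (((z - k) - (z - l)) * u z) = cmod (k - l) * cmod (u z)"
        by (simp add: norm_mult norm_minus_commute)
      also have "\<dots> \<le> cmod (k - l) * K"
        using K[OF that] by (simp add: mult_left_mono)
      also have "\<dots> < 1"
        using k \<open>K > 0\<close> by (simp add: field_simps)
      finally show ?thesis .
    qed
    then show "unit_residue G (\<lambda>z. z - l) \<longleftrightarrow> unit_residue G (\<lambda>z. z - k)"
      by (intro unit_residue_perturb[OF G _ _ u _ bezout] closed_disk_algebra_intros)
  qed
qed

text \<open>
  Take the points \<open>k\<close> and \<open>j\<close> on the ray through \<open>l\<close> at distance \<open>s\<close> from \<open>l\<close>, inside and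
  outside the disk. The factor at \<open>j\<close> is invertible, and perturbing it into the factor at
  \<open>k\<close> requires \<open>2 s |u| < 1\<close>, where \<open>u = (1 - G / G k) / (z - k)\<close> is the cofactor at \<open>k\<close>.
  By the maximum principle it suffices to bound this on the unit circle. There
  \<open>s \<le> |z - k|\<close>, so near \<open>l\<close> the bound follows from the smallness of \<open>1 - G / G k\<close>, and away
  from \<open>l\<close> it follows from the smallness of \<open>s\<close>.
\<close>

lemma unit_residue_linear_at_boundary:
  assumes G: "G \<in> closed_disk_algebra" and l: "cmod l = 1" "G l \<noteq> 0"
  obtains k where "k \<in> ball 0 1" "G k \<noteq> 0" "unit_residue G (\<lambda>z. z - k)"
    and "unit_residue G (\<lambda>z. z - l)"
proof -
  define m where "m = cmod (G l)"
  have "m > 0"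
    using l by (simp add: m_def)
  obtain M where "M > 0" and M: "\<And>z. z \<in> cball 0 1 \<Longrightarrow> cmod (G z) \<le> M"
    using closed_disk_algebra_bounded[OF G] by blast
  have "\<exists>d>0. \<forall>x'\<in>cball 0 1. dist x' l < d \<longrightarrow> dist (G x') (G l) < m / 8"
    using closed_disk_algebraD(1)[OF G, unfolded continuous_on_iff, rule_format, of l "m / 8"] l \<open>m > 0\<close>
    by simp
  then obtain d where "d > 0"
    and d: "\<And>z. z \<in> cball 0 1 \<Longrightarrow> cmod (z - l) < d \<Longrightarrow> cmod (G z - G l) < m / 8"
    by (auto simp: dist_norm)
  \<comment> \<open>\<open>C\<close> bounds \<open>|1 - G z / G k|\<close>, as \<open>|G k| \<ge> m / 2\<close> for \<open>k\<close> close to \<open>l\<close>.\<close>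
  define C where "C = 1 + 2 * M / m"
  define s where "s = min (1/2) (d / (8 * C))"
  have "C \<ge> 1"
    using \<open>m > 0\<close> \<open>M > 0\<close> by (simp add: C_def)
  have s: "0 < s" "s \<le> 1/2" "8 * C * s \<le> d"
    using \<open>d > 0\<close> \<open>C \<ge> 1\<close> by (auto simp: s_def min_def field_simps)
  have "8 * s \<le> 8 * C * s"
    using \<open>C \<ge> 1\<close> s by simp
  with s have sd: "8 * s \<le> d"
    by linarith
  define k where "k = of_real (1 - s) * l"
  define j where "j = of_real (1 + s) * l"
  have "cmod k = \<bar>1 - s\<bar> * cmod l"
    by (simp only: k_def norm_mult norm_of_real)
  then have norm_k: "cmod k = 1 - s"
    using s l by simp
  then have k: "k \<in> ball 0 1"
    using s by simp
  have kl: "cmod (k - l) = s"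
  proof -
    have "k - l = of_real (- s) * l"
      by (simp add: k_def algebra_simps)
    with l s show ?thesis
      by (simp add: norm_mult)
  qed
  have kj: "cmod (k - j) = 2 * s"
  proof -
    have "k - j = of_real (- (2 * s)) * l"
      by (simp add: k_def j_def algebra_simps)
    with l s show ?thesis
      by (simp only: norm_mult norm_of_real)
  qed
  have "cmod (G k - G l) < m / 8"
    using k kl s sd by (intro d) auto
  then have Gk: "cmod (G k) > 7 / 8 * m"
    using norm_triangle_ineq2[of "G l" "G k"] by (simp add: m_def norm_minus_commute)
  then have Gk0: "G k \<noteq> 0"
    using \<open>m > 0\<close> by auto
  obtain u where u: "u \<in> closed_disk_algebra"
    and bezout: "\<And>z. z \<in> cball 0 1 \<Longrightarrow> (z - k) * u z + G z * (1 / G k) = 1"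
    using linear_factor_bezout[OF G k Gk0] by blast
  have bound: "cmod (of_real (2 * s) * u z) \<le> 4 / 7" if z: "cmod z = 1" for z
  proof -
    have zk: "s \<le> cmod (z - k)"
    proof -
      have "cmod z - cmod k \<le> cmod (z - k)"
        by (rule norm_triangle_ineq2)
      then show ?thesis
        using z norm_k by simp
    qed
    then have "z - k \<noteq> 0"
      using s by auto
    then have "u z = (G k - G z) / G k / (z - k)"
      using bezout[of z] z Gk0 by (simp add: field_simps)
    then have norm_u: "cmod (of_real (2 * s) * u z) = 2 * s * cmod (G k - G z) / (cmod (G k) * cmod (z - k))"
      using s by (simp add: norm_mult norm_divide)
    have pos: "0 < cmod (G k) * cmod (z - k)"
      using Gk0 \<open>z - k \<noteq> 0\<close> by simp
    show ?thesis
    \<comment> \<open>Near \<open>l\<close>: \<open>|1 - G z / G k| \<le> (1/4) / (7/8) = 2/7\<close> and \<open>2 s / |z - k| \<le> 2\<close>.\<close>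
    proof (cases "cmod (z - l) < d")
      case True
      then have "cmod (G z - G l) < m / 8"
        using z by (intro d) auto
      then have "cmod (G k - G z) < m / 4"
        using \<open>cmod (G k - G l) < m / 8\<close> norm_triangle_ineq4[of "G k - G l" "G z - G l"] by simp
      then have "2 * s * cmod (G k - G z) \<le> 2 * s * (m / 4)"
        using s by (intro mult_left_mono) auto
      also have "\<dots> = 4 / 7 * ((7 / 8 * m) * s)"
        by simp
      also have "\<dots> \<le> 4 / 7 * (cmod (G k) * cmod (z - k))"
        using Gk zk s \<open>m > 0\<close> by (intro mult_left_mono mult_mono) auto
      finally show ?thesis
        unfolding norm_u using pos by (simp add: divide_le_eq)
    next
      case False
      have zk': "d / 2 \<le> cmod (z - k)"
        using False kl sd norm_triangle_ineq[of "z - k" "k - l"] s by simp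
      have "cmod (G k - G z) \<le> cmod (G k) + M"
        using norm_triangle_ineq4[of "G k" "G z"] M[of z] z by simp
      also have "\<dots> \<le> C * cmod (G k)"
      proof -
        have "M \<le> 2 * M / m * cmod (G k)"
          using Gk \<open>m > 0\<close> \<open>M > 0\<close> by (simp add: field_simps)
        then show ?thesis
          by (simp add: C_def algebra_simps)
      qed
      finally have "2 * s * cmod (G k - G z) \<le> 2 * s * (C * cmod (G k))"
        using s by (intro mult_left_mono) auto
      also have "\<dots> = (2 * C * s) * cmod (G k)"
        by simp
      also have "\<dots> \<le> (1 / 2 * cmod (z - k)) * cmod (G k)"
        using zk' s(3) by (intro mult_right_mono) auto
      also have "\<dots> \<le> 4 / 7 * (cmod (G k) * cmod (z - k))"
        by (simp add: mult.commute)
      finally show ?thesis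
        unfolding norm_u using pos by (simp add: divide_le_eq)
    qed
  qed
  have bound_disk: "cmod (of_real (2 * s) * u z) \<le> 4 / 7" if "z \<in> cball 0 1" for z
  proof (rule closed_disk_algebra_maximum_modulus[OF _ bound that])
    show "(\<lambda>z. of_real (2 * s) * u z) \<in> closed_disk_algebra"
      using u by (intro closed_disk_algebra_intros)
  qed
  have step: "unit_residue G (\<lambda>z. z - k) \<longleftrightarrow> unit_residue G (\<lambda>z. z - i)"
    if i: "cmod (k - i) \<le> 2 * s" for i
  proof -
    have "cmod (((z - i) - (z - k)) * u z) < 1" if "z \<in> cball 0 1" for z
    proof -
      have "cmod (((z - i) - (z - k)) * u z) \<le> 2 * s * cmod (u z)"
        using i by (simp add: norm_mult mult_right_mono)
      also have "\<dots> = cmod (of_real (2 * s) * u z)"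
        using s by (simp add: norm_mult)
      also have "\<dots> < 1"
        using bound_disk[OF that] by linarith
      finally show ?thesis .
    qed
    then show ?thesis
      by (intro unit_residue_perturb[OF G _ _ u _ bezout] closed_disk_algebra_intros)
  qed
  have "unit_residue G (\<lambda>z. z - j)"
  proof (rule unit_residue_linear_outside)
    have "cmod j = \<bar>1 + s\<bar> * cmod l"
      by (simp only: j_def norm_mult norm_of_real)
    then show "cmod j > 1"
      using s(1) l(1) by simp
  qed
  then have *: "unit_residue G (\<lambda>z. z - k)"
    by (rule iffD2[OF step[OF eq_refl[OF kj]]])
  have "cmod (k - l) \<le> 2 * s"
    using kl s(1) by linarith
  from iffD1[OF step[OF this] *] have "unit_residue G (\<lambda>z. z - l)" .
  then show ?thesis
    by (rule that[OF k Gk0 *])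
qed

text \<open>
  The zeros of \<open>G\<close> in the open disk are countable, hence do not disconnect it, and the
  property is locally constant on the rest. A starting point where it holds exists near the
  circle, since \<open>G\<close> cannot vanish on the whole circle without vanishing at \<open>l\<close>.
\<close>

lemma unit_residue_linear:
  assumes G: "G \<in> closed_disk_algebra" and l: "l \<in> cball 0 1 \<Longrightarrow> G l \<noteq> 0"
  shows "unit_residue G (\<lambda>z. z - l)"
proof -
  consider "cmod l > 1" | "cmod l = 1" | "cmod l < 1"
    by linarith
  then show ?thesis
  proof cases
    case 1
    then show ?thesis
      by (rule unit_residue_linear_outside)
  next
    case 2
    then show ?thesis
      using unit_residue_linear_at_boundary[OF G, of l] l by auto
  next
    case 3
    define S where "S = ball 0 1 - {z \<in> ball 0 1. G z = 0}"
    have "l \<in> S"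
      using 3 l by (auto simp: S_def)
    have "countable {z \<in> ball 0 1. G z = 0}"
    proof (cases "G constant_on ball 0 1")
      case True
      then have "{z \<in> ball 0 1. G z = 0} = {}"
        using \<open>l \<in> S\<close> by (auto simp: S_def constant_on_def)
      then show ?thesis
        by (simp only: countable_empty)
    next
      case False
      have "fsigma (ball 0 1 :: complex set)"
      proof (rule open_Union_compact_subsets[OF open_ball[of "0::complex" 1]])
        fix C :: "nat \<Rightarrow> complex set"
        assume "\<And>n. compact (C n)" "\<Union>(range C) = ball 0 1"
        then show ?thesis
          unfolding fsigma_Union_compact by (intro exI[of _ C]) auto
      qed
      then show ?thesis
        using False closed_disk_algebraD(2)[OF G] by (intro holomorphic_countable_zeros) auto
    qed
    then have "connected S"
      unfolding S_def by (intro connected_open_diff_countable) auto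
    obtain w where w: "cmod w = 1" "G w \<noteq> 0"
      using closed_disk_algebra_maximum_modulus[OF G, of 0 l] l 3 by fastforce
    obtain k where k: "k \<in> S" "unit_residue G (\<lambda>z. z - k)"
      using unit_residue_linear_at_boundary[OF G w] by (auto simp: S_def)
    show ?thesis
    proof (rule connected_induction_simple[OF \<open>connected S\<close> k(1) \<open>l \<in> S\<close>, of "\<lambda>x. unit_residue G (\<lambda>z. z - x)"])
      show "unit_residue G (\<lambda>z. z - k)"
        by (rule k)
      fix x assume "x \<in> S"
      then obtain d where "d > 0" and d: "\<And>y. cmod (y - x) < d \<Longrightarrow>
          unit_residue G (\<lambda>z. z - x) \<longleftrightarrow> unit_residue G (\<lambda>z. z - y)"
        using unit_residue_linear_locally_constant[OF G, of x] by (auto simp: S_def)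
      show "\<exists>T. openin (top_of_set S) T \<and> x \<in> T \<and>
          (\<forall>y\<in>T. \<forall>y'\<in>T. unit_residue G (\<lambda>z. z - y) \<longrightarrow> unit_residue G (\<lambda>z. z - y'))"
      proof (intro exI[of _ "S \<inter> ball x d"] conjI ballI impI)
        show "openin (top_of_set S) (S \<inter> ball x d)"
          by (intro openin_open_Int open_ball)
        show "x \<in> S \<inter> ball x d"
          using \<open>x \<in> S\<close> \<open>d > 0\<close> by simp
        fix y y'
        assume "y \<in> S \<inter> ball x d" "y' \<in> S \<inter> ball x d"
        then have near: "cmod (y - x) < d" "cmod (y' - x) < d"
          by (auto simp: dist_norm norm_minus_commute)
        assume "unit_residue G (\<lambda>z. z - y)"
        then have "unit_residue G (\<lambda>z. z - x)"
          by (rule iffD2[OF d[OF near(1)]])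
        then show "unit_residue G (\<lambda>z. z - y')"
          by (rule iffD1[OF d[OF near(2)]])
      qed
    qed
  qed
qed

lemma unit_residue_poly:
  assumes G: "G \<in> closed_disk_algebra"
    and "p \<noteq> 0" "\<And>z. z \<in> cball 0 1 \<Longrightarrow> poly p z = 0 \<Longrightarrow> G z \<noteq> 0"
  shows "unit_residue G (poly p)"
  using assms(2,3)
proof (induction "degree p" arbitrary: p)
  case 0
  then obtain c where "p = [:c:]"
    by (metis degree_eq_zeroE)
  with 0 show ?case
    by (intro unit_residue_nonvanishing) auto
next
  case (Suc n)
  then have "\<not> constant (poly p)"
    by (simp add: Fundamental_Theorem_Algebra.constant_degree)
  then obtain l where l: "poly p l = 0"
    using fundamental_theorem_of_algebra by blast
  then obtain q where q: "p = [:- l, 1:] * q"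
    by (metis dvdE poly_eq_0_iff_dvd)
  then have "q \<noteq> 0"
    using Suc by auto
  then have "n = degree q"
    using Suc(2) by (simp add: q degree_mult_eq del: mult_pCons_left)
  then have "unit_residue G (poly q)"
    using Suc q \<open>q \<noteq> 0\<close> by (intro Suc(1)) auto
  moreover have "unit_residue G (\<lambda>z. z - l)"
    using G Suc l by (intro unit_residue_linear) auto
  moreover have "poly p = (\<lambda>z. (z - l) * poly q z)"
    by (auto simp: q algebra_simps)
  ultimately show ?case
    using G unit_residue_mult[of G "\<lambda>z. z - l" "poly q"]
    by (simp add: closed_disk_algebra_diff)
qed

text \<open>
  A polynomial close enough to \<open>f\<close> still has no common zero with \<open>G\<close>, so its residue class
  contains a unit, and this is passed on to \<open>f\<close>.
\<close>

theorem unit_residue_of_bezout: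
  assumes algebra: "f \<in> closed_disk_algebra" "G \<in> closed_disk_algebra"
      "u \<in> closed_disk_algebra" "v \<in> closed_disk_algebra"
    and bezout: "\<And>z. z \<in> cball 0 1 \<Longrightarrow> f z * u z + G z * v z = 1"
  shows "unit_residue G f"
proof (cases "\<exists>z\<in>cball 0 1. G z = 0")
  case False
  then have "(\<lambda>z. (1 - f z) / G z) \<in> closed_disk_algebra"
    using algebra by (intro closed_disk_algebra_intros) auto
  with False show ?thesis
    unfolding unit_residue_def by (intro bexI[of _ "\<lambda>z. (1 - f z) / G z"]) auto
next
  case True
  obtain K where "K > 0" and K: "\<And>z. z \<in> cball 0 1 \<Longrightarrow> cmod (u z) \<le> K"
    using closed_disk_algebra_bounded[OF algebra(3)] by blast
  obtain p where p: "\<And>z. z \<in> cball 0 1 \<Longrightarrow> cmod (f z - poly p z) < 1 / K"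
    using closed_disk_algebra_polynomial_approximation[OF algebra(1), of "1 / K"] \<open>K > 0\<close> by auto
  have near: "cmod ((poly p z - f z) * u z) < 1" if "z \<in> cball 0 1" for z
  proof -
    have "cmod ((poly p z - f z) * u z) \<le> cmod (f z - poly p z) * K"
      using K[OF that] by (simp add: norm_mult norm_minus_commute mult_left_mono)
    also have "\<dots> < 1"
      using p[OF that] \<open>K > 0\<close> by (simp add: field_simps)
    finally show ?thesis .
  qed
  have zero: "G z \<noteq> 0" if "z \<in> cball 0 1" "poly p z = 0" for z
  proof
    assume "G z = 0"
    then have "f z * u z = 1"
      using bezout[OF that(1)] by simp
    then have "(poly p z - f z) * u z = - 1"
      using that(2) by simp
    with near[OF that(1)] show False
      by simp
  qed
  \<comment> \<open>If \<open>p\<close> were \<open>0\<close>, any zero of \<open>G\<close> would be a common zero.\<close>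
  then have "p \<noteq> 0"
    using True by auto
  then have "unit_residue G (poly p)"
    using zero algebra by (intro unit_residue_poly) auto
  then show ?thesis
    using unit_residue_perturb[of G f "poly p" u v, OF _ _ _ _ _ bezout near] algebra by auto
qed

section \<open>Functions that are constant on a divisor\<close>

text \<open>
  The condition that cuts \<open>A(D)\<^sub>B\<close> out of the disk algebra: modulo the divisor
  \<open>\<Sum>k\<in>I. m k \<cdot> a k\<close>, the function is a constant.
\<close>

definition constant_on_divisor ::
  "nat set \<Rightarrow> (nat \<Rightarrow> complex) \<Rightarrow> (nat \<Rightarrow> nat) \<Rightarrow> (complex \<Rightarrow> complex) \<Rightarrow> bool" where
  "constant_on_divisor I a m f \<longleftrightarrow>
     (\<forall>j\<in>I. \<forall>k\<in>I. f (a j) = f (a k)) \<and>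
     (\<forall>k\<in>I. \<forall>i\<in>{1..m k - 1}. (deriv ^^ i) f (a k) = 0)"

lemma constant_on_divisor_const: "constant_on_divisor I a m (\<lambda>z. c)"
  by (auto simp: constant_on_divisor_def)

lemma constant_on_divisor_cong:
  assumes "f holomorphic_on ball 0 1" "g holomorphic_on ball 0 1"
    and "\<And>z. z \<in> ball 0 1 \<Longrightarrow> f z = g z" and "a ` I \<subseteq> ball 0 1"
  shows "constant_on_divisor I a m f \<longleftrightarrow> constant_on_divisor I a m g"
proof -
  have "(deriv ^^ i) f (a k) = (deriv ^^ i) g (a k)" if "k \<in> I" for i k
    using assms that by (intro higher_deriv_transform_within_open[of f "ball 0 1" g]) auto
  moreover have "f (a k) = g (a k)" if "k \<in> I" for k
    using assms that by auto
  ultimately show ?thesis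
    unfolding constant_on_divisor_def by auto
qed

lemma constant_on_divisor_add:
  assumes "f holomorphic_on ball 0 1" "g holomorphic_on ball 0 1" "a ` I \<subseteq> ball 0 1"
    and "constant_on_divisor I a m f" "constant_on_divisor I a m g"
  shows "constant_on_divisor I a m (\<lambda>z. f z + g z)"
proof -
  have deriv_add: "(deriv ^^ i) (\<lambda>z. f z + g z) (a k) = (deriv ^^ i) f (a k) + (deriv ^^ i) g (a k)"
    if "k \<in> I" for i k
    using assms(1-3) that by (intro higher_deriv_add[of f "ball 0 1" g]) auto
  have "f (a j) + g (a j) = f (a k) + g (a k)" if "j \<in> I" "k \<in> I" for j k
  proof -
    have "f (a j) = f (a k)" "g (a j) = g (a k)"
      using assms(4,5) that unfolding constant_on_divisor_def by blast+
    then show ?thesis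
      by simp
  qed
  moreover have "(deriv ^^ i) (\<lambda>z. f z + g z) (a k) = 0" if "k \<in> I" "i \<in> {1..m k - 1}" for k i
    using assms(4,5) that by (simp add: deriv_add constant_on_divisor_def)
  ultimately show ?thesis
    unfolding constant_on_divisor_def by blast
qed

text \<open>
  In the Leibniz formula all terms but one contain a vanishing derivative of \<open>f\<close>.
\<close>

lemma higher_deriv_mult_constant_to_order:
  fixes f g :: "complex \<Rightarrow> complex"
  assumes "f holomorphic_on S" "g holomorphic_on S" "open S" "z \<in> S"
    and "\<And>j. 1 \<le> j \<Longrightarrow> j \<le> i \<Longrightarrow> (deriv ^^ j) f z = 0"
  shows "(deriv ^^ i) (\<lambda>w. f w * g w) z = f z * (deriv ^^ i) g z"
proof -
  have "(deriv ^^ i) (\<lambda>w. f w * g w) z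
      = (\<Sum>j = 0..i. of_nat (i choose j) * (deriv ^^ j) f z * (deriv ^^ (i - j)) g z)"
    using assms by (intro higher_deriv_mult)
  also have "\<dots> = (\<Sum>j \<in> {0}. of_nat (i choose j) * (deriv ^^ j) f z * (deriv ^^ (i - j)) g z)"
    using assms(5) by (intro sum.mono_neutral_right) auto
  finally show ?thesis
    by simp
qed

lemma constant_on_divisor_mult:
  assumes f: "f holomorphic_on ball 0 1" and g: "g holomorphic_on ball 0 1"
    and a: "a ` I \<subseteq> ball 0 1"
    and "constant_on_divisor I a m f" "constant_on_divisor I a m g"
  shows "constant_on_divisor I a m (\<lambda>z. f z * g z)"
  unfolding constant_on_divisor_def
proof (intro conjI ballI)
  show "f (a j) * g (a j) = f (a k) * g (a k)" if "j \<in> I" "k \<in> I" for j k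
  proof -
    have "f (a j) = f (a k)" "g (a j) = g (a k)"
      using assms(4,5) that unfolding constant_on_divisor_def by blast+
    then show ?thesis
      by simp
  qed
  show "(deriv ^^ i) (\<lambda>z. f z * g z) (a k) = 0" if "k \<in> I" "i \<in> {1..m k - 1}" for k i
  proof -
    have "(deriv ^^ i) (\<lambda>w. f w * g w) (a k) = f (a k) * (deriv ^^ i) g (a k)"
      using assms(4) a that
      by (intro higher_deriv_mult_constant_to_order[OF f g]) (auto simp: constant_on_divisor_def)
    then show ?thesis
      using assms(5) that by (simp add: constant_on_divisor_def)
  qed
qed

lemma constant_on_divisor_inverse:
  assumes f: "f holomorphic_on ball 0 1" and a: "a ` I \<subseteq> ball 0 1"
    and const: "constant_on_divisor I a m f"
    and nz: "\<And>z. z \<in> ball 0 1 \<Longrightarrow> f z \<noteq> 0"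
  shows "constant_on_divisor I a m (\<lambda>z. 1 / f z)"
  unfolding constant_on_divisor_def
proof (intro conjI ballI)
  show "1 / f (a j) = 1 / f (a k)" if "j \<in> I" "k \<in> I" for j k
  proof -
    have "f (a j) = f (a k)"
      using const that unfolding constant_on_divisor_def by blast
    then show ?thesis
      by simp
  qed
  have holo: "(\<lambda>z. 1 / f z) holomorphic_on ball 0 1"
    using f nz by (intro holomorphic_intros) auto
  show "(deriv ^^ i) (\<lambda>z. 1 / f z) (a k) = 0" if "k \<in> I" "i \<in> {1..m k - 1}" for k i
  proof -
    have ak: "a k \<in> ball 0 1"
      using a that by auto
    have "f (a k) * (deriv ^^ i) (\<lambda>z. 1 / f z) (a k) = (deriv ^^ i) (\<lambda>w. f w * (1 / f w)) (a k)"
      using const that ak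
      by (intro higher_deriv_mult_constant_to_order[OF f holo, symmetric])
        (auto simp: constant_on_divisor_def)
    also have "\<dots> = (deriv ^^ i) (\<lambda>w. 1) (a k)"
      using f holo nz ak
      by (intro higher_deriv_transform_within_open[of _ "ball 0 1"] holomorphic_intros) auto
    also have "\<dots> = 0"
      using that by simp
    finally show ?thesis
      using nz ak by simp
  qed
qed

text \<open>
  The functions vanishing on the divisor form an ideal of all holomorphic functions, not only
  of those that are constant on it. This is what brings a coefficient from the full disk
  algebra back into the subalgebra.
\<close>

lemma constant_on_divisor_multiple:
  assumes f: "f holomorphic_on ball 0 1" and h: "h holomorphic_on ball 0 1"
    and a: "a ` I \<subseteq> ball 0 1"
    and const: "constant_on_divisor I a m f" and c: "\<And>k. k \<in> I \<Longrightarrow> f (a k) = c"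
  shows "constant_on_divisor I a m (\<lambda>z. (f z - c) * h z)"
  unfolding constant_on_divisor_def
proof (intro conjI ballI)
  show "(f (a j) - c) * h (a j) = (f (a k) - c) * h (a k)" if "j \<in> I" "k \<in> I" for j k
    using c that by simp
  have holo: "(\<lambda>z. f z - c) holomorphic_on ball 0 1"
    using f by (intro holomorphic_intros)
  have "constant_on_divisor I a m (\<lambda>z. f z + - c)"
    using f a const by (intro constant_on_divisor_add constant_on_divisor_const holomorphic_intros)
  then have const': "constant_on_divisor I a m (\<lambda>z. f z - c)"
    by simp
  show "(deriv ^^ i) (\<lambda>z. (f z - c) * h z) (a k) = 0" if "k \<in> I" "i \<in> {1..m k - 1}" for k i
  proof -
    have "(deriv ^^ i) (\<lambda>z. (f z - c) * h z) (a k) = (f (a k) - c) * (deriv ^^ i) h (a k)"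
      using const' a that
      by (intro higher_deriv_mult_constant_to_order[OF holo h]) (auto simp: constant_on_divisor_def)
    with c that show ?thesis
      by simp
  qed
qed

text \<open>
  With \<open>F = f + c g\<close> and \<open>\<gamma>\<close> its nonzero value on the divisor, \<open>F\<close> is comaximal with \<open>g\<close> and
  with \<open>F - \<gamma>\<close>, hence with their product \<open>G\<close>. A coefficient \<open>h\<close> for the pair \<open>(F, G)\<close> in the
  disk algebra gives the coefficient \<open>c + (F - \<gamma>) h\<close> for \<open>(f, g)\<close>, which is constant on the
  divisor.
\<close>

theorem reducible_constant_on_divisor:
  assumes algebra: "f \<in> closed_disk_algebra" "g \<in> closed_disk_algebra"
      "u \<in> closed_disk_algebra" "v \<in> closed_disk_algebra"
    and bezout: "\<And>z. z \<in> cball 0 1 \<Longrightarrow> f z * u z + g z * v z = 1"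
    and a: "a ` I \<subseteq> ball 0 1"
    and f: "constant_on_divisor I a m f" and g: "constant_on_divisor I a m g"
  obtains h where "h \<in> closed_disk_algebra" "constant_on_divisor I a m h"
    "\<And>z. z \<in> cball 0 1 \<Longrightarrow> f z + h z * g z \<noteq> 0"
proof (cases "I = {}")
  case True
  have "unit_residue g f"
    using unit_residue_of_bezout[OF algebra bezout] by simp
  then show ?thesis
    using that True by (auto simp: unit_residue_def constant_on_divisor_def)
next
  case False
  then obtain k0 where k0: "k0 \<in> I"
    by blast
  define c where "c = (if f (a k0) = 0 then 1 else (0::complex))"
  define F where "F = (\<lambda>z. f z + c * g z)"
  define w where "w = (\<lambda>z. v z - c * u z)"
  define \<gamma> where "\<gamma> = F (a k0)"
  define G where "G = (\<lambda>z. g z * (F z - \<gamma>))"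
  have F: "F \<in> closed_disk_algebra" and w: "w \<in> closed_disk_algebra"
    unfolding F_def w_def by (intro closed_disk_algebra_intros algebra)+
  have G: "G \<in> closed_disk_algebra"
    unfolding G_def using algebra F by (intro closed_disk_algebra_intros)
  have F_const: "constant_on_divisor I a m F"
    unfolding F_def using algebra a f g
    by (intro constant_on_divisor_add constant_on_divisor_mult constant_on_divisor_const
        holomorphic_intros) (auto dest: closed_disk_algebraD)
  have F_val: "F (a k) = \<gamma>" if "k \<in> I" for k
    using F_const k0 that unfolding constant_on_divisor_def \<gamma>_def by blast
  have "a k0 \<in> cball 0 1"
    using a k0 by auto
  from bezout[OF this] have "f (a k0) \<noteq> 0 \<or> g (a k0) \<noteq> 0"
    by auto
  then have "\<gamma> \<noteq> 0"
    by (cases "f (a k0) = 0") (simp_all add: \<gamma>_def F_def c_def)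
  \<comment> \<open>This is the product of \<open>F u + g w = 1\<close> and \<open>F / \<gamma> - (F - \<gamma>) / \<gamma> = 1\<close>, sorted by
    multiples of \<open>F\<close> and of \<open>G\<close>.\<close>
  have bezout_FG: "F z * (u z + g z * w z * (1 / \<gamma>)) + G z * (- (1 / \<gamma>) * w z) = 1" if "z \<in> cball 0 1" for z
  proof -
    have "F z * (u z + g z * w z * (1 / \<gamma>)) + G z * (- (1 / \<gamma>) * w z) = F z * u z + g z * w z"
    proof -
      have "F z * (u z + g z * w z * e) + G z * (- e * w z) = F z * u z + g z * w z * (\<gamma> * e)" for e
        by (simp add: G_def algebra_simps)
      from this[of "1 / \<gamma>"] \<open>\<gamma> \<noteq> 0\<close> show ?thesis
        by simp
    qed
    also have "\<dots> = f z * u z + g z * v z"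
      by (simp add: F_def w_def algebra_simps)
    finally show ?thesis
      using bezout[OF that] by simp
  qed
  have "(\<lambda>z. u z + g z * w z * (1 / \<gamma>)) \<in> closed_disk_algebra"
    "(\<lambda>z. - (1 / \<gamma>) * w z) \<in> closed_disk_algebra"
    by (intro closed_disk_algebra_intros algebra w)+
  from unit_residue_of_bezout[OF F G this bezout_FG] have "unit_residue G F" .
  then obtain h where h: "h \<in> closed_disk_algebra"
    and nz: "\<And>z. z \<in> cball 0 1 \<Longrightarrow> F z + h z * G z \<noteq> 0"
    by (auto simp: unit_residue_def)
  show ?thesis
  proof (rule that)
    show "(\<lambda>z. c + (F z - \<gamma>) * h z) \<in> closed_disk_algebra"
      using F h by (intro closed_disk_algebra_intros)
    show "constant_on_divisor I a m (\<lambda>z. c + (F z - \<gamma>) * h z)"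
      using F h F_const F_val a
      by (intro constant_on_divisor_add constant_on_divisor_const constant_on_divisor_multiple
          holomorphic_intros) (auto dest: closed_disk_algebraD)
    show "f z + (c + (F z - \<gamma>) * h z) * g z \<noteq> 0" if "z \<in> cball 0 1" for z
    proof -
      have "f z + (c + (F z - \<gamma>) * h z) * g z = F z + h z * G z"
        by (simp add: F_def G_def algebra_simps)
      with nz[OF that] show ?thesis
        by simp
    qed
  qed
qed


section \<open>The ring of the Blaschke product\<close>

text \<open>
  Passing to the continuous extension gives access to the compactness of the closed disk and
  to boundary values.
\<close>

lemma disk_algebra_iff:
  "f \<in> disk_algebra \<longleftrightarrow> (\<exists>g\<in>closed_disk_algebra. f = restrict g unit_disk)"
proof
  assume f: "f \<in> disk_algebra"
  then obtain g where g: "continuous_on (cball 0 1) g" "\<And>z. z \<in> unit_disk \<Longrightarrow> g z = f z"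
    by (auto simp: disk_algebra_def)
  have "f holomorphic_on unit_disk"
    using f by (simp add: disk_algebra_def)
  then have "g holomorphic_on unit_disk"
    by (rule holomorphic_transform) (simp add: g(2))
  moreover have "f = restrict g unit_disk"
    using f g(2) by (auto simp: disk_algebra_def extensional_def restrict_def)
  ultimately show "\<exists>g\<in>closed_disk_algebra. f = restrict g unit_disk"
    using g(1) by (auto intro: closed_disk_algebraI)
next
  assume "\<exists>g\<in>closed_disk_algebra. f = restrict g unit_disk"
  then obtain g where g: "g \<in> closed_disk_algebra" and f: "f = restrict g unit_disk"
    by blast
  obtain K where "K > 0" "\<And>z. z \<in> cball 0 1 \<Longrightarrow> cmod (g z) \<le> K"
    by (rule closed_disk_algebra_bounded[OF g]) (rule that)
  then have "bounded (f ` unit_disk)"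
    by (intro boundedI[of _ K]) (auto simp: f)
  moreover have "f holomorphic_on unit_disk"
    by (rule holomorphic_transform[OF closed_disk_algebraD(2)[OF g]]) (simp add: f)
  ultimately show "f \<in> disk_algebra"
    using closed_disk_algebraD(1)[OF g] by (auto simp: disk_algebra_def f)
qed

lemma carrier_disk_algebra_B_iff:
  assumes a: "a ` zero_indices N \<subseteq> unit_disk"
  shows "f \<in> carrier (disk_algebra_B N a m) \<longleftrightarrow>
    (\<exists>g\<in>closed_disk_algebra. constant_on_divisor (zero_indices N) a m g \<and> f = restrict g unit_disk)"
proof -
  have "constant_on_divisor (zero_indices N) a m (restrict g unit_disk) \<longleftrightarrow>
      constant_on_divisor (zero_indices N) a m g" if "g \<in> closed_disk_algebra" for g
  proof (rule constant_on_divisor_cong[OF _ _ _ a])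
    show g: "g holomorphic_on unit_disk"
      using that by (rule closed_disk_algebraD)
    show "restrict g unit_disk holomorphic_on unit_disk"
      by (rule holomorphic_transform[OF g]) simp
  qed simp
  moreover have "f \<in> carrier (disk_algebra_B N a m) \<longleftrightarrow>
      f \<in> disk_algebra \<and> constant_on_divisor (zero_indices N) a m f"
    by (simp add: disk_algebra_B_def constant_on_divisor_def)
  ultimately show ?thesis
    by (auto simp: disk_algebra_iff)
qed

lemma restrict_in_disk_algebra_B:
  assumes "a ` zero_indices N \<subseteq> unit_disk"
    and "g \<in> closed_disk_algebra" "constant_on_divisor (zero_indices N) a m g"
  shows "restrict g unit_disk \<in> carrier (disk_algebra_B N a m)"
  using assms(2,3) by (auto simp: carrier_disk_algebra_B_iff[OF assms(1)])

lemma add_restrict_disk_algebra_B: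
  "restrict f unit_disk \<oplus>\<^bsub>disk_algebra_B N a m\<^esub> restrict g unit_disk
    = (\<lambda>z\<in>unit_disk. f z + g z)"
  by (auto simp: disk_algebra_B_def)

lemma mult_restrict_disk_algebra_B:
  "restrict f unit_disk \<otimes>\<^bsub>disk_algebra_B N a m\<^esub> restrict g unit_disk
    = (\<lambda>z\<in>unit_disk. f z * g z)"
  by (auto simp: disk_algebra_B_def)

lemma
  assumes a: "a ` zero_indices N \<subseteq> unit_disk"
    and f: "f \<in> carrier (disk_algebra_B N a m)" and g: "g \<in> carrier (disk_algebra_B N a m)"
  shows disk_algebra_B_add_closed: "f \<oplus>\<^bsub>disk_algebra_B N a m\<^esub> g \<in> carrier (disk_algebra_B N a m)"
    and disk_algebra_B_mult_closed: "f \<otimes>\<^bsub>disk_algebra_B N a m\<^esub> g \<in> carrier (disk_algebra_B N a m)"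
proof -
  obtain f' g' where f': "f' \<in> closed_disk_algebra" "constant_on_divisor (zero_indices N) a m f'"
      "f = restrict f' unit_disk"
    and g': "g' \<in> closed_disk_algebra" "constant_on_divisor (zero_indices N) a m g'"
      "g = restrict g' unit_disk"
    using f g by (auto simp: carrier_disk_algebra_B_iff[OF a])
  have "constant_on_divisor (zero_indices N) a m (\<lambda>z. f' z + g' z)"
    using f' g' a by (intro constant_on_divisor_add) (auto dest: closed_disk_algebraD)
  then show "f \<oplus>\<^bsub>disk_algebra_B N a m\<^esub> g \<in> carrier (disk_algebra_B N a m)"
    unfolding f'(3) g'(3) add_restrict_disk_algebra_B
    by (intro restrict_in_disk_algebra_B[OF a] closed_disk_algebra_add f'(1) g'(1))
  have "constant_on_divisor (zero_indices N) a m (\<lambda>z. f' z * g' z)"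
    using f' g' a by (intro constant_on_divisor_mult) (auto dest: closed_disk_algebraD)
  then show "f \<otimes>\<^bsub>disk_algebra_B N a m\<^esub> g \<in> carrier (disk_algebra_B N a m)"
    unfolding f'(3) g'(3) mult_restrict_disk_algebra_B
    by (intro restrict_in_disk_algebra_B[OF a] closed_disk_algebra_mult f'(1) g'(1))
qed

lemma abelian_monoid_disk_algebra_B:
  assumes a: "a ` zero_indices N \<subseteq> unit_disk"
  shows "abelian_monoid (disk_algebra_B N a m)"
proof (rule abelian_monoidI)
  show "f \<oplus>\<^bsub>disk_algebra_B N a m\<^esub> g \<in> carrier (disk_algebra_B N a m)"
    if "f \<in> carrier (disk_algebra_B N a m)" "g \<in> carrier (disk_algebra_B N a m)" for f g
    using that by (rule disk_algebra_B_add_closed[OF a])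
  show "\<zero>\<^bsub>disk_algebra_B N a m\<^esub> \<in> carrier (disk_algebra_B N a m)"
    unfolding carrier_disk_algebra_B_iff[OF a]
    by (intro bexI[of _ "\<lambda>z. 0"]) (auto simp: disk_algebra_B_def constant_on_divisor_const)
  show "\<zero>\<^bsub>disk_algebra_B N a m\<^esub> \<oplus>\<^bsub>disk_algebra_B N a m\<^esub> f = f"
    if "f \<in> carrier (disk_algebra_B N a m)" for f
    using that unfolding carrier_disk_algebra_B_iff[OF a]
    by (auto simp: disk_algebra_B_def)
qed (auto simp: disk_algebra_B_def)

text \<open>
  A function without zeros on the closed disk has its reciprocal in the disk algebra, and the
  reciprocal is again constant on the divisor.
\<close>

lemma unimodular_one_disk_algebra_B:
  assumes a: "a ` zero_indices N \<subseteq> unit_disk"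
    and f: "f \<in> closed_disk_algebra" "constant_on_divisor (zero_indices N) a m f"
    and nz: "\<And>z. z \<in> cball 0 1 \<Longrightarrow> f z \<noteq> 0"
    and x: "x 1 = restrict f unit_disk"
  shows "unimodular (disk_algebra_B N a m) 1 x"
proof -
  let ?R = "disk_algebra_B N a m"
  interpret abelian_monoid ?R
    by (rule abelian_monoid_disk_algebra_B[OF a])
  define y where "y = (\<lambda>z\<in>unit_disk. 1 / f z)"
  have "constant_on_divisor (zero_indices N) a m (\<lambda>z. 1 / f z)"
    using f nz a by (intro constant_on_divisor_inverse) (auto dest: closed_disk_algebraD)
  moreover have "(\<lambda>z. 1 / f z) \<in> closed_disk_algebra"
    using f nz by (intro closed_disk_algebra_intros)
  ultimately have y: "y \<in> carrier ?R"
    unfolding y_def by (intro restrict_in_disk_algebra_B[OF a])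
  have x1: "x 1 \<in> carrier ?R"
    unfolding x by (intro restrict_in_disk_algebra_B[OF a] f)
  have "x 1 \<otimes>\<^bsub>?R\<^esub> y = \<one>\<^bsub>?R\<^esub>"
    unfolding x y_def mult_restrict_disk_algebra_B using nz
    by (auto simp: disk_algebra_B_def)
  moreover have "x 1 \<otimes>\<^bsub>?R\<^esub> y \<in> carrier ?R"
    using a x1 y by (rule disk_algebra_B_mult_closed)
  ultimately have "(\<Oplus>\<^bsub>?R\<^esub>j\<in>{1..1}. x j \<otimes>\<^bsub>?R\<^esub> y) = \<one>\<^bsub>?R\<^esub>"
    by (simp add: finsum_insert)
  then show ?thesis
    unfolding unimodular_def using x1 y by (intro conjI bexI[of _ "\<lambda>_. y"]) auto
qed

lemma reducible_pair_disk_algebra_B: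
  assumes a: "a ` zero_indices N \<subseteq> unit_disk"
    and t: "unimodular (disk_algebra_B N a m) 2 t"
  shows "reducible (disk_algebra_B N a m) 2 t"
proof -
  let ?R = "disk_algebra_B N a m" and ?I = "zero_indices N"
  interpret abelian_monoid ?R
    by (rule abelian_monoid_disk_algebra_B[OF a])
  obtain b where t_carrier: "t \<in> {1..2} \<rightarrow> carrier ?R" and b_carrier: "b \<in> {1..2} \<rightarrow> carrier ?R"
    and sum: "(\<Oplus>\<^bsub>?R\<^esub>j\<in>{1..2}. t j \<otimes>\<^bsub>?R\<^esub> b j) = \<one>\<^bsub>?R\<^esub>"
    using t by (auto simp: unimodular_def)
  have carrier: "t 1 \<in> carrier ?R" "t 2 \<in> carrier ?R" "b 1 \<in> carrier ?R" "b 2 \<in> carrier ?R"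
    using t_carrier b_carrier by auto
  then obtain f g u v where algebra: "f \<in> closed_disk_algebra" "g \<in> closed_disk_algebra"
      "u \<in> closed_disk_algebra" "v \<in> closed_disk_algebra"
    and const: "constant_on_divisor ?I a m f" "constant_on_divisor ?I a m g"
    and restr: "t 1 = restrict f unit_disk" "t 2 = restrict g unit_disk"
      "b 1 = restrict u unit_disk" "b 2 = restrict v unit_disk"
    unfolding carrier_disk_algebra_B_iff[OF a] by blast
  have "{1..2} = {1, 2::nat}"
    by auto
  then have "t 1 \<otimes>\<^bsub>?R\<^esub> b 1 \<oplus>\<^bsub>?R\<^esub> t 2 \<otimes>\<^bsub>?R\<^esub> b 2 = \<one>\<^bsub>?R\<^esub>"
    using sum carrier disk_algebra_B_mult_closed[OF a] by (simp add: finsum_insert)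
  then have eq: "(\<lambda>z\<in>unit_disk. f z * u z + g z * v z) = (\<lambda>z\<in>unit_disk. 1)"
    unfolding restr mult_restrict_disk_algebra_B add_restrict_disk_algebra_B
    by (simp add: disk_algebra_B_def)
  have disk: "f z * u z + g z * v z = 1" if "z \<in> unit_disk" for z
    using fun_cong[OF eq, of z] that by simp
  have "(\<lambda>z. f z * u z + g z * v z) \<in> closed_disk_algebra"
    by (intro closed_disk_algebra_intros algebra)
  then have cont: "continuous_on (closure unit_disk) (\<lambda>z. f z * u z + g z * v z)"
    using closed_disk_algebraD(1) by simp
  \<comment> \<open>The identity extends to the boundary by continuity.\<close>
  have bezout: "f z * u z + g z * v z = 1" if "z \<in> cball 0 1" for z
    using that by (intro continuous_constant_on_closure[OF cont disk]) simp_all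
  obtain h where h: "h \<in> closed_disk_algebra" "constant_on_divisor ?I a m h"
    and nz: "\<And>z. z \<in> cball 0 1 \<Longrightarrow> f z + h z * g z \<noteq> 0"
    using reducible_constant_on_divisor[OF algebra bezout a const] by blast
  define x where "x = restrict h unit_disk"
  have x: "x \<in> carrier ?R"
    unfolding x_def by (intro restrict_in_disk_algebra_B[OF a] h)
  have "unimodular ?R 1 (\<lambda>j. t j \<oplus>\<^bsub>?R\<^esub> x \<otimes>\<^bsub>?R\<^esub> t 2)"
  proof (rule unimodular_one_disk_algebra_B[OF a])
    show "(\<lambda>z. f z + h z * g z) \<in> closed_disk_algebra"
      using algebra h by (intro closed_disk_algebra_intros)
    show "constant_on_divisor ?I a m (\<lambda>z. f z + h z * g z)"
      using algebra h const a
      by (intro constant_on_divisor_add constant_on_divisor_mult holomorphic_intros)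
        (auto dest: closed_disk_algebraD)
    show "t 1 \<oplus>\<^bsub>?R\<^esub> x \<otimes>\<^bsub>?R\<^esub> t 2 = (\<lambda>z\<in>unit_disk. f z + h z * g z)"
      unfolding restr x_def mult_restrict_disk_algebra_B add_restrict_disk_algebra_B ..
  qed (rule nz)
  then show ?thesis
    unfolding reducible_def using x by (intro bexI[of _ "\<lambda>_. x"]) auto
qed

theorem theorem4p5:
  fixes B :: "complex \<Rightarrow> complex" and N :: enat
    and a :: "nat \<Rightarrow> complex" and m :: "nat \<Rightarrow> nat"
  assumes "blaschke_product B N a m"
    and "circle_null (boundary_cluster_set {z \<in> unit_disk. B z = 0})"
  shows "bass_stable_rank (disk_algebra_B N a m) = 1"
proof -
  let ?S = "{enat n | n. 1 \<le> n \<and> (\<forall>t. unimodular (disk_algebra_B N a m) (n + 1) t \<longrightarrow>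
      reducible (disk_algebra_B N a m) (n + 1) t)}"
  have "a ` zero_indices N \<subseteq> unit_disk"
    using assms(1) by (simp add: blaschke_product_def)
  then have "\<forall>t. unimodular (disk_algebra_B N a m) (1 + 1) t \<longrightarrow>
      reducible (disk_algebra_B N a m) (1 + 1) t"
    using reducible_pair_disk_algebra_B by (metis one_add_one)
  then have "enat 1 \<in> ?S"
    by blast
  moreover have "1 \<le> s" if "s \<in> ?S" for s
    using that by (auto simp: one_enat_def)
  ultimately have "Inf ?S = 1"
    by (intro antisym Inf_lower Inf_greatest) (auto simp: one_enat_def)
  then show ?thesis
    unfolding bass_stable_rank_def .
qed

end
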